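(* Consider a deterministic pushdown reward machine with stack alphabet $\Gamma$, used in an episodic task of length $n$. Let $m$ be the maximum number of symbols that can be added to the stack at any transition of the machine, and let $e$ be the maximum number of $\epsilon$-transitions pushing symbols to the stack in a single $\epsilon$-sequence of the machine. If $|\Gamma|\ge 2$, policies (which have access to the entire stack) incur a blowup in $O\left(|\Gamma|^{nm(e+1)}\right)$. If $|\Gamma|=1$, policies incur a blowup in $O\left(nm(e+1)\right)$.
   Context: A pushdown reward machine (pdRM) is a tuple $\langle U,u_0,F,\Sigma,\Gamma,Z,\delta_u,\delta_r\rangle$, where $U$ is a finite set of states, $u_0\in U$ is the initial state, $F$ (with $F\not\subseteq U$) is the set of final states, $\Sigma$ is the input alphabet, $\Gamma$ is the stack alphabet, $Z\in\Gamma$ is the initial stack symbol, $\delta_u:U\times(\Sigma\cup\{\epsilon\})\times(\Gamma\cup\{\epsilon\})\to(U\cup F)\times\Gamma^*$ is the (possibly partial) transition function and $\delta_r:U\times(\Sigma\cup\{\epsilon\})\times(\Gamma\cup\{\epsilon\})\to\mathbb{R}$ is the reward function; $\epsilon$ is the empty string. If $\delta_u(u,\sigma,z)=(u',\zeta')$, then on reading $\sigma$ the machine moves from configuration $\langle u,z\zeta\rangle$ to $\langle u',\zeta'\zeta\rangle$ (top of the stack leftmost), i.e. $\zeta'$ replaces $z$ on top of the stack; no symbol is popped if $z=\epsilon$ and none is pushed if $\zeta'=\epsilon$. If $\sigma=\epsilon$, no input is read and the transition is called an $\epsilon$-transition. The machine is deterministic if, for every state $u$ and stack symbol $z$, whenever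 $\delta_u(u,\epsilon,z)$ is defined, $\delta_u(u,\sigma,z)$ is not defined for any $\sigma\in\Sigma$. An $\epsilon$-sequence is a sequence of $\epsilon$-transitions which are taken before the machine must read a symbol to advance. The machine is used to give rewards in a Markov decision process (MDP) with state set $S$ and action set $A$; at each timestep it reads one input symbol determined by the MDP transition, so in an episode of length $n$ it reads an input word of length $n$. A policy is a function $\pi:S\times U\times\Gamma^*\to\Delta(A)$, where $\Delta(A)$ is the set of probability distributions on $A$. The size of a policy is the size of the table representing it. The blowup is the factor by which the stack enlarges the state space on which policies are defined, hence the size of policies; it is measured by the number of possible strings that can appear on the stack (the cardinality of the stack language) for input words of length $n$.
   Formalization: For |Γ|=1 the formal claim assumes n ≥ 1 and m ≥ 1, since otherwise the bound nm(e+1) is 0 while the initial stack string already makes the blowup at least 1. *)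

theory Defs
  imports Complex_Main "HOL-Library.Landau_Symbols"
begin

(* In the transition and reward functions, None stands for the empty string in both the
   input and the stack argument; an undefined transition is None as a result. *)
record ('u, 'i, 'g) pdrm =
  states :: "'u set"
  init :: 'u
  finals :: "'u set"
  inputs :: "'i set"
  stack_syms :: "'g set"
  init_stack :: 'g
  trans :: "'u \<Rightarrow> 'i option \<Rightarrow> 'g option \<Rightarrow> ('u \<times> 'g list) option"
  reward :: "'u \<Rightarrow> 'i option \<Rightarrow> 'g option \<Rightarrow> real"

definition is_pdrm :: "('u, 'i, 'g) pdrm \<Rightarrow> bool" where
  "is_pdrm M \<longleftrightarrow>
     finite (states M) \<and> init M \<in> states M \<and> \<not> finals M \<subseteq> states M \<and>
     finite (inputs M) \<and> finite (stack_syms M) \<and> init_stack M \<in> stack_syms M \<and>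
     (\<forall>u a z u' p. trans M u a z = Some (u', p) \<longrightarrow>
        u \<in> states M \<and> set_option a \<subseteq> inputs M \<and> set_option z \<subseteq> stack_syms M \<and>
        u' \<in> states M \<union> finals M \<and> set p \<subseteq> stack_syms M)"

definition deterministic :: "('u, 'i, 'g) pdrm \<Rightarrow> bool" where
  "deterministic M \<longleftrightarrow>
     (\<forall>u\<in>states M. \<forall>z\<in>stack_syms M. trans M u None (Some z) \<noteq> None \<longrightarrow>
        (\<forall>a\<in>inputs M. trans M u (Some a) (Some z) = None))"

(* The head of the list is the top of the stack. *)
type_synonym ('u, 'g) config = "'u \<times> 'g list"

(* A single move with label a that pushes the string p. *)
definition move ::
  "('u, 'i, 'g) pdrm \<Rightarrow> 'i option \<Rightarrow> 'g list \<Rightarrow> ('u, 'g) config \<Rightarrow> ('u, 'g) config \<Rightarrow> bool"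
where
  "move M a p c c' \<longleftrightarrow>
     (\<exists>z rest. snd c = (case z of None \<Rightarrow> [] | Some x \<Rightarrow> [x]) @ rest \<and>
        trans M (fst c) a z = Some (fst c', p) \<and> snd c' = p @ rest)"

(* The number counts only the epsilon-transitions that push at least one symbol. *)
inductive eps_seq ::
  "('u, 'i, 'g) pdrm \<Rightarrow> nat \<Rightarrow> ('u, 'g) config \<Rightarrow> ('u, 'g) config \<Rightarrow> bool"
  for M
where
  eps_nil: "eps_seq M 0 c c"
| eps_snoc: "eps_seq M k c c' \<Longrightarrow> move M None p c' c'' \<Longrightarrow>
    eps_seq M (if p = [] then k else Suc k) c c''"

(* A timestep consists of an epsilon-sequence, possibly empty, followed by the reading of one
   symbol; after_reading M w c means that c is reached immediately after the last symbol
   of w has been read. *)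
inductive after_reading ::
  "('u, 'i, 'g) pdrm \<Rightarrow> 'i list \<Rightarrow> ('u, 'g) config \<Rightarrow> bool"
  for M
where
  after_nil: "after_reading M [] (init M, [init_stack M])"
| after_snoc: "after_reading M w c \<Longrightarrow> eps_seq M k c c' \<Longrightarrow> move M (Some a) p c' c'' \<Longrightarrow>
    after_reading M (w @ [a]) c''"

(* All strings on the stack at any point of an episode of n timesteps, including the
   intermediate points of the epsilon-sequences and the point after the n-th reading.
   An epsilon-sequence that follows the n-th reading precedes, and belongs to, timestep n + 1;
   the language with that sequence included is contained in stack_language M (n + 1). *)
definition stack_language :: "('u, 'i, 'g) pdrm \<Rightarrow> nat \<Rightarrow> 'g list set" where
  "stack_language M n =
     {snd c | c. \<exists>w. length w \<le> n \<and> after_reading M w c} \<union>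
     {snd c' | c'. \<exists>w c k. length w < n \<and> after_reading M w c \<and> eps_seq M k c c'}"

(* The factor by which the table of a policy on S \<times> U \<times> (stack strings) exceeds one on S \<times> U. *)
definition blowup :: "('u, 'i, 'g) pdrm \<Rightarrow> nat \<Rightarrow> nat" where
  "blowup M n = card (stack_language M n)"

(* A transition adds the string it pushes, even if it also pops a symbol.
   The 0 only serves machines without transitions. *)
definition max_push :: "('u, 'i, 'g) pdrm \<Rightarrow> nat" where
  "max_push M = Max (insert 0 {length p | p. \<exists>u a z u'. trans M u a z = Some (u', p)})"

(* Only epsilon-sequences that occur in computations from the initial configuration count. *)
definition eps_push_counts :: "('u, 'i, 'g) pdrm \<Rightarrow> nat set" where
  "eps_push_counts M = {k. \<exists>w c c'. after_reading M w c \<and> eps_seq M k c c'}"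

(* Meaningful only if eps_push_counts M is finite: an epsilon-cycle may push forever. *)
definition max_eps_pushes :: "('u, 'i, 'g) pdrm \<Rightarrow> nat" where
  "max_eps_pushes M = Max (eps_push_counts M)"

(* Deterministic machines for which the maximum number of pushing epsilon-transitions exists. *)
definition admissible :: "('u, 'i, 'g) pdrm \<Rightarrow> bool" where
  "admissible M \<longleftrightarrow> is_pdrm M \<and> deterministic M \<and> finite (eps_push_counts M)"

end

(* Every string on the stack is p or p @ [Z], where Z is the initial stack symbol and p consists
   of pushed symbols that are still present, so that p has length at most N = n m (e + 1).
   There are at most 2 |\<Gamma>|^N such p if |\<Gamma>| \<ge> 2, and N + 1 if |\<Gamma>| = 1. Bounding the stack
   height by N + 1 alone would lose a factor |\<Gamma>|, which no constant uniform in the machine absorbs. *)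
theory Submission
  imports Defs
begin

text \<open>\<open>K\<close> counts pushed symbols only. The initial symbol stays outside the count,
  so the initial stack already qualifies for \<open>K = 0\<close>; the shape without it covers
  stacks from which it has been popped.\<close>

definition stacks_upto :: "('u, 'i, 'g) pdrm \<Rightarrow> nat \<Rightarrow> 'g list set" where
  "stacks_upto M K = (let L = {p. set p \<subseteq> stack_syms M \<and> length p \<le> K}
     in L \<union> (\<lambda>p. p @ [init_stack M]) ` L)"

lemma finite_stacks_upto:
  assumes "finite (stack_syms M)"
  shows "finite (stacks_upto M K)"
  using assms by (simp add: stacks_upto_def Let_def finite_lists_length_le)

text \<open>The factor 2 stands for the two shapes; the strings of length at most \<open>K\<close>
  are counted by the geometric sum.\<close>

lemma card_stacks_upto_le:
  assumes "finite (stack_syms M)"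
  shows "card (stacks_upto M K) \<le> 2 * (\<Sum>i\<le>K. card (stack_syms M) ^ i)"
proof -
  define L where "L = {p. set p \<subseteq> stack_syms M \<and> length p \<le> K}"
  have "card (stacks_upto M K) \<le> card L + card ((\<lambda>p. p @ [init_stack M]) ` L)"
    unfolding stacks_upto_def Let_def L_def by (rule card_Un_le)
  also have "\<dots> \<le> 2 * card L"
    using card_image_le[of L "\<lambda>p. p @ [init_stack M]"] assms
    by (simp add: L_def finite_lists_length_le)
  finally show ?thesis
    using assms by (simp add: L_def card_lists_length_le)
qed

lemma stacks_upto_mono:
  assumes "K \<le> K'"
  shows "stacks_upto M K \<subseteq> stacks_upto M K'"
  using assms by (fastforce simp: stacks_upto_def Let_def)

text \<open>\<open>Max\<close> is an upper bound only on a finite set. By \<open>is_pdrm\<close>,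
  transitions are defined only on a finite set of arguments, and the push lengths lie in the image
  of that set.\<close>

lemma length_push_le_max_push:
  assumes "is_pdrm M" "trans M u a z = Some (u', p)"
  shows "length p \<le> max_push M"
proof -
  let ?D = "states M \<times> insert None (Some ` inputs M) \<times> insert None (Some ` stack_syms M)"
  have "{length p | p. \<exists>u a z u'. trans M u a z = Some (u', p)}
      \<subseteq> (\<lambda>(u, a, z). length (snd (the (trans M u a z)))) ` ?D" (is "?P \<subseteq> _")
  proof
    fix l assume "l \<in> ?P"
    then obtain u a z u' p where t: "trans M u a z = Some (u', p)" "l = length p"
      by blast
    with assms(1) have "u \<in> states M" "set_option a \<subseteq> inputs M" "set_option z \<subseteq> stack_syms M"
      unfolding is_pdrm_def by blast+
    then have "(u, a, z) \<in> ?D"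
      by (cases a; cases z) auto
    with t show "l \<in> (\<lambda>(u, a, z). length (snd (the (trans M u a z)))) ` ?D"
      by (intro image_eqI[where x = "(u, a, z)"]) auto
  qed
  moreover have "finite ?D"
    using assms(1) by (simp add: is_pdrm_def)
  ultimately have "finite ?P"
    by (meson finite_imageI finite_subset)
  then show ?thesis
    using assms(2) unfolding max_push_def by (intro Max_ge) auto
qed

text \<open>A pop removes a symbol either of the pushed part or of the bottom, so the remainder
  keeps its shape and its \<open>K\<close>; only the pushed string raises the bound.\<close>

lemma move_stacks_upto:
  assumes "is_pdrm M" "move M a p c c'" "snd c \<in> stacks_upto M K"
  shows "snd c' \<in> stacks_upto M (K + length p)" and "length p \<le> max_push M"
proof -
  obtain z rest where z: "snd c = (case z of None \<Rightarrow> [] | Some x \<Rightarrow> [x]) @ rest"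
    and t: "trans M (fst c) a z = Some (fst c', p)" and c': "snd c' = p @ rest"
    using assms(2) unfolding move_def by blast
  have p: "set p \<subseteq> stack_syms M"
    using assms(1) t unfolding is_pdrm_def by blast
  obtain q where q: "set q \<subseteq> stack_syms M" "length q \<le> K"
    and c: "snd c = q \<or> snd c = q @ [init_stack M]"
    using assms(3) by (auto simp: stacks_upto_def Let_def)
  have "\<exists>r. set r \<subseteq> stack_syms M \<and> length r \<le> K \<and> (rest = r \<or> rest = r @ [init_stack M])"
  proof (cases z)
    case None
    with z c q show ?thesis by auto
  next
    case (Some x)
    with z have x: "snd c = x # rest" by simp
    show ?thesis
    proof (cases q)
      \<comment> \<open>With no pushed symbol left, the popped one is the initial stack symbol and
        nothing remains.\<close>
      case Nil
      with x c have "rest = []" by auto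
      then show ?thesis by (intro exI[of _ "[]"]) simp
    next
      case (Cons y r)
      with x c q show ?thesis by (intro exI[of _ r]) auto
    qed
  qed
  then obtain r where "set r \<subseteq> stack_syms M" "length r \<le> K" "rest = r \<or> rest = r @ [init_stack M]"
    by blast
  with p have "set (p @ r) \<subseteq> stack_syms M" "length (p @ r) \<le> K + length p"
    and "snd c' = p @ r \<or> snd c' = (p @ r) @ [init_stack M]"
    using c' by auto
  then show "snd c' \<in> stacks_upto M (K + length p)"
    by (auto simp: stacks_upto_def Let_def)
  show "length p \<le> max_push M"
    using assms(1) t by (rule length_push_le_max_push)
qed

lemma eps_seq_stacks_upto:
  assumes "eps_seq M k c c'" "is_pdrm M" "snd c \<in> stacks_upto M K"
  shows "snd c' \<in> stacks_upto M (K + k * max_push M)"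
  using assms
proof induction
  case (eps_nil c)
  then show ?case by simp
next
  case (eps_snoc k c c' p c'')
  note mv = move_stacks_upto[OF eps_snoc.prems(1) eps_snoc.hyps(2) eps_snoc.IH[OF eps_snoc.prems]]
  \<comment> \<open>A transition with \<open>p = []\<close> adds nothing, which is why
    \<open>k\<close> may skip it; any other adds at most \<open>max_push M\<close>, paid for by the
    step to \<open>Suc k\<close>.\<close>
  have "K + k * max_push M + length p \<le> K + (if p = [] then k else Suc k) * max_push M"
    using mv(2) by simp
  then show ?case
    using mv(1) stacks_upto_mono by blast
qed

lemma eps_pushes_le_max:
  assumes "admissible M" "after_reading M w c" "eps_seq M k c c'"
  shows "k \<le> max_eps_pushes M"
proof -
  have "k \<in> eps_push_counts M"
    using assms(2,3) unfolding eps_push_counts_def by blast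
  then show ?thesis
    using assms(1) by (simp add: admissible_def max_eps_pushes_def)
qed

text \<open>One timestep has at most \<open>max_eps_pushes M\<close> pushing epsilon-transitions and
  one reading move, each adding at most \<open>max_push M\<close> symbols; hence the factor
  \<open>max_eps_pushes M + 1\<close>.\<close>

lemma after_reading_stacks_upto:
  assumes "after_reading M w c" "admissible M"
  shows "snd c \<in> stacks_upto M (length w * max_push M * (max_eps_pushes M + 1))"
  using assms
proof induction
  case after_nil
  then show ?case
    by (simp add: stacks_upto_def Let_def)
next
  case (after_snoc w c k c' a p c'')
  let ?K = "length w * max_push M * (max_eps_pushes M + 1)"
  have M: "is_pdrm M"
    using after_snoc.prems by (simp add: admissible_def)
  have "snd c' \<in> stacks_upto M (?K + k * max_push M)"
    using eps_seq_stacks_upto[OF after_snoc.hyps(2) M] after_snoc.IH after_snoc.prems by blast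
  note mv = move_stacks_upto[OF M after_snoc.hyps(3) this]
  have "k * max_push M \<le> max_eps_pushes M * max_push M"
    using eps_pushes_le_max[OF after_snoc.prems after_snoc.hyps(1,2)] by simp
  then have "?K + k * max_push M + length p
      \<le> length (w @ [a]) * max_push M * (max_eps_pushes M + 1)"
    using mv(2) by (simp add: algebra_simps add_mono)
  then show ?case
    using mv(1) stacks_upto_mono by blast
qed

lemma stack_language_subset_stacks_upto:
  assumes "admissible M"
  shows "stack_language M n \<subseteq> stacks_upto M (n * max_push M * (max_eps_pushes M + 1))"
proof -
  let ?N = "\<lambda>n. n * max_push M * (max_eps_pushes M + 1)"
  have "snd c \<in> stacks_upto M (?N n)" if "length w \<le> n" "after_reading M w c" for w c
  proof -
    have "?N (length w) \<le> ?N n"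
      using that(1) by (intro mult_right_mono) auto
    then show ?thesis
      using after_reading_stacks_upto[OF that(2) assms] stacks_upto_mono by blast
  qed
  moreover have "snd c' \<in> stacks_upto M (?N n)"
    if "length w < n" "after_reading M w c" "eps_seq M k c c'" for w c k c'
  proof -
    have "k * max_push M \<le> max_eps_pushes M * max_push M"
      using eps_pushes_le_max[OF assms that(2,3)] by simp
    \<comment> \<open>An epsilon-sequence after \<open>w\<close> belongs to timestep
      \<open>Suc (length w)\<close>, which is at most \<open>n\<close>, so its pushes fit into the
      share of that timestep.\<close>
    then have "?N (length w) + k * max_push M \<le> ?N (Suc (length w))"
      by (simp add: algebra_simps trans_le_add2)
    also have "\<dots> \<le> ?N n"
      using that(1) by (intro mult_right_mono) auto
    finally show ?thesis
      using eps_seq_stacks_upto[OF that(3) _ after_reading_stacks_upto[OF that(2) assms]]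
        assms stacks_upto_mono unfolding admissible_def by blast
  qed
  ultimately show ?thesis
    unfolding stack_language_def by blast
qed

text \<open>The last term dominates: for base at least 2 the bound \<open>2 * g ^ N\<close> on the
  earlier terms is itself at most the next power, so adding that power at most doubles it.\<close>

lemma sum_powers_le:
  fixes g :: nat
  assumes "g \<ge> 2"
  shows "(\<Sum>i\<le>N. g ^ i) \<le> 2 * g ^ N"
proof (induction N)
  case 0
  then show ?case by simp
next
  case (Suc N)
  have "2 * g ^ N \<le> g ^ Suc N"
    using assms by simp
  with Suc show ?case
    unfolding sum.atMost_Suc by linarith
qed

lemma blowup_le:
  assumes "admissible M"
  shows "blowup M n
    \<le> 2 * (\<Sum>i\<le>n * max_push M * (max_eps_pushes M + 1). card (stack_syms M) ^ i)"
proof -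
  have fin: "finite (stack_syms M)"
    using assms by (simp add: admissible_def is_pdrm_def)
  show ?thesis
    unfolding blowup_def
    using card_mono[OF finite_stacks_upto[OF fin] stack_language_subset_stacks_upto[OF assms]]
      card_stacks_upto_le[OF fin] by (rule order_trans)
qed

theorem theorem1:
  shows
    "(\<forall>(M :: ('u, 'i, 'g) pdrm) n. admissible M \<longrightarrow> finite (stack_language M n)) \<and>
     (\<lambda>(M :: ('u, 'i, 'g) pdrm, n). real (blowup M n))
       \<in> O[principal {(M, n). admissible M \<and> card (stack_syms M) \<ge> 2}](
          \<lambda>(M, n). real (card (stack_syms M)) ^ (n * max_push M * (max_eps_pushes M + 1))) \<and>
     (\<lambda>(M :: ('u, 'i, 'g) pdrm, n). real (blowup M n))
       \<in> O[principal {(M, n). admissible M \<and> card (stack_syms M) = 1 \<and> n \<ge> 1 \<and> max_push M \<ge> 1}](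
          \<lambda>(M, n). real (n * max_push M * (max_eps_pushes M + 1)))"
proof (intro conjI allI impI)
  fix M :: "('u, 'i, 'g) pdrm" and n
  assume M: "admissible M"
  then have "finite (stack_syms M)"
    by (simp add: admissible_def is_pdrm_def)
  then show "finite (stack_language M n)"
    using stack_language_subset_stacks_upto[OF M] finite_stacks_upto by (meson finite_subset)
next
  \<comment> \<open>The constant 4 combines the factor 2 for the two stack shapes with the factor 2
    of the geometric sum.\<close>
  have "real (blowup M n)
      \<le> 4 * real (card (stack_syms M)) ^ (n * max_push M * (max_eps_pushes M + 1))"
    if "admissible M" "card (stack_syms M) \<ge> 2" for M :: "('u, 'i, 'g) pdrm" and n
  proof -
    have "blowup M n \<le> 4 * card (stack_syms M) ^ (n * max_push M * (max_eps_pushes M + 1))"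
      using blowup_le[OF that(1), of n]
        sum_powers_le[OF that(2), of "n * max_push M * (max_eps_pushes M + 1)"] by linarith
    then have "real (blowup M n)
        \<le> real (4 * card (stack_syms M) ^ (n * max_push M * (max_eps_pushes M + 1)))"
      by (simp only: of_nat_le_iff)
    then show ?thesis
      by simp
  qed
  then show "(\<lambda>(M :: ('u, 'i, 'g) pdrm, n). real (blowup M n))
      \<in> O[principal {(M, n). admissible M \<and> card (stack_syms M) \<ge> 2}](
        \<lambda>(M, n). real (card (stack_syms M)) ^ (n * max_push M * (max_eps_pushes M + 1)))"
    \<comment> \<open>Along a principal filter, eventually means everywhere on the set, so the one
      constant must serve all machines and all \<open>n\<close>.\<close>
    by (intro bigoI[where c = 4]) (auto simp: eventually_principal)
next
  have "real (blowup M n) \<le> 4 * real (n * max_push M * (max_eps_pushes M + 1))"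
    if "admissible M" "card (stack_syms M) = 1" "n \<ge> 1" "max_push M \<ge> 1"
    for M :: "('u, 'i, 'g) pdrm" and n
  proof -
    define N where "N = n * max_push M * (max_eps_pushes M + 1)"
    have "blowup M n \<le> 2 * (N + 1)"
      using blowup_le[OF that(1), of n] that(2) by (simp add: N_def)
    \<comment> \<open>This turns \<open>2 * (N + 1)\<close> into \<open>4 * N\<close>. For
      \<open>N = 0\<close> the stack language still contains the initial stack, so no multiple of
      \<open>N\<close> could bound the blowup.\<close>
    moreover have "N \<ge> 1"
      using that(3,4) by (simp add: N_def Suc_le_eq)
    ultimately have "real (blowup M n) \<le> 4 * real N"
      by simp
    then show ?thesis
      by (simp only: N_def)
  qed
  then show "(\<lambda>(M :: ('u, 'i, 'g) pdrm, n). real (blowup M n))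
      \<in> O[principal {(M, n). admissible M \<and> card (stack_syms M) = 1 \<and> n \<ge> 1 \<and> max_push M \<ge> 1}](
        \<lambda>(M, n). real (n * max_push M * (max_eps_pushes M + 1)))"
    by (intro bigoI[where c = 4]) (auto simp: eventually_principal simp del: of_nat_mult of_nat_add)
qed

end
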